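(* Let $E$ be a finite MV-effect algebra. The following are equivalent: (i) $E$ is Boolean; (ii) $E$ admits an (S1)–(S4) operation; (iii) $E$ admits a sequential product (an operation satisfying (S1)–(S5)). Moreover, every effect algebra (in particular every finite MV-effect algebra) admits an (S1)–(S3) operation, so for finite MV-effect algebras (S4) is the first axiom whose imposition can make such operations fail to exist.
   Context: An effect algebra is $(E,0,1,\oplus)$ with $\oplus$ a partial binary operation satisfying: if $a\oplus b$ is defined then $b\oplus a$ is defined and equal; associativity ($(a\oplus b)\oplus c$ defined iff $a\oplus(b\oplus c)$ defined, and then equal); for each $a$ there is a unique $a'$ with $a\oplus a'=1$; and $a\oplus 1$ defined implies $a=0$. Write $a\perp b$ when $a\oplus b$ is defined. A finite MV-effect algebra is a finite effect algebra which is a lattice with the Riesz decomposition property (an MV-algebra viewed as effect algebra); equivalently, up to isomorphism, $E_{\mathbf u}=\{x\in\mathbb{Z}_{\ge0}^r:0\le x\le\mathbf u\}$ for some $\mathbf u\in\mathbb{N}_{>0}^r$ with $x\oplus y=x+y$ defined iff $x+y\le\mathbf u$ and top $\mathbf u$. For a total binary operation $\circ$ on $E$, write $a\mid b$ for $a\circ b=b\circ a$. The axioms: (S1) $b\perp c\Rightarrow a\circ(b\oplus c)=(a\circ b)\oplus(a\circ c)$; (S2) $1\circ a=a$; (S3) $a\circ b=0\Rightarrow a\circ b=b\circ a$; (S4) if $a\mid b$ then $a\mid b'$ and $a\circ(b\circ c)=(a\circ b)\circ c$ for all $c$; (S5) if $c\mid a$ and $c\mid b$ then $c\mid (a\circ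 b)$, and $c\mid(a\oplus b)$ whenever $a\perp b$. An (S1)–(Sk) operation is a total binary operation satisfying (S1) through (Sk); a sequential product is an (S1)–(S5) operation. *)

theory Defs
  imports Complex_Main "HOL-Algebra.Lattice"
begin

text \<open>The partial operation is option-valued: \<open>osum E a b = Some c\<close> means that the sum of
  \<open>a\<close> and \<open>b\<close> is defined and equals \<open>c\<close>. All axioms are relative to the carrier.\<close>

record 'a ea_struct = "'a partial_object" +
  osum :: "'a \<Rightarrow> 'a \<Rightarrow> 'a option"
  ezero :: 'a
  eone :: 'a

definition perp :: "('a, 'm) ea_struct_scheme \<Rightarrow> 'a \<Rightarrow> 'a \<Rightarrow> bool" where
  "perp E a b \<longleftrightarrow> osum E a b \<noteq> None"

locale effect_algebra =
  fixes E :: "('a, 'm) ea_struct_scheme"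
  assumes zero_closed: "ezero E \<in> carrier E"
    and one_closed: "eone E \<in> carrier E"
    and osum_closed:
      "\<lbrakk>a \<in> carrier E; b \<in> carrier E; osum E a b = Some c\<rbrakk> \<Longrightarrow> c \<in> carrier E"
    and osum_comm:
      "\<lbrakk>a \<in> carrier E; b \<in> carrier E; perp E a b\<rbrakk>
        \<Longrightarrow> perp E b a \<and> osum E b a = osum E a b"
    \<comment> \<open>equality of partial values: one side is defined iff the other is, and then they agree\<close>
    and osum_assoc:
      "\<lbrakk>a \<in> carrier E; b \<in> carrier E; c \<in> carrier E\<rbrakk>
        \<Longrightarrow> Option.bind (osum E a b) (\<lambda>d. osum E d c)
          = Option.bind (osum E b c) (\<lambda>d. osum E a d)"
    and ex1_supp:
      "a \<in> carrier E \<Longrightarrow> \<exists>!b. b \<in> carrier E \<and> osum E a b = Some (eone E)"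
    and perp_one: "\<lbrakk>a \<in> carrier E; perp E a (eone E)\<rbrakk> \<Longrightarrow> a = ezero E"

definition supp :: "('a, 'm) ea_struct_scheme \<Rightarrow> 'a \<Rightarrow> 'a" where
  "supp E a = (THE b. b \<in> carrier E \<and> osum E a b = Some (eone E))"

definition ea_order :: "('a, 'm) ea_struct_scheme \<Rightarrow> 'a gorder" where
  "ea_order E = \<lparr>carrier = carrier E, eq = (=),
     le = (\<lambda>a b. \<exists>c\<in>carrier E. osum E a c = Some b)\<rparr>"

definition riesz_decomposition :: "('a, 'm) ea_struct_scheme \<Rightarrow> bool" where
  "riesz_decomposition E \<longleftrightarrow>
    (\<forall>a\<in>carrier E. \<forall>b\<in>carrier E. \<forall>c\<in>carrier E. \<forall>d.
       osum E b c = Some d \<and> a \<sqsubseteq>\<^bsub>ea_order E\<^esub> d \<longrightarrow>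
       (\<exists>b\<^sub>1\<in>carrier E. \<exists>c\<^sub>1\<in>carrier E.
          b\<^sub>1 \<sqsubseteq>\<^bsub>ea_order E\<^esub> b \<and> c\<^sub>1 \<sqsubseteq>\<^bsub>ea_order E\<^esub> c \<and> osum E b\<^sub>1 c\<^sub>1 = Some a))"

definition finite_MV_effect_algebra :: "('a, 'm) ea_struct_scheme \<Rightarrow> bool" where
  "finite_MV_effect_algebra E \<longleftrightarrow>
    effect_algebra E \<and> finite (carrier E) \<and> lattice (ea_order E) \<and> riesz_decomposition E"

text \<open>An effect algebra is Boolean if, with its own order, constants and orthosupplement, it is a
  Boolean algebra: a distributive lattice in which \<open>supp E a\<close> is a complement of \<open>a\<close>.\<close>

definition boolean_effect_algebra :: "('a, 'm) ea_struct_scheme \<Rightarrow> bool" where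
  "boolean_effect_algebra E \<longleftrightarrow>
    effect_algebra E \<and> lattice (ea_order E) \<and>
    (\<forall>a\<in>carrier E. \<forall>b\<in>carrier E. \<forall>c\<in>carrier E.
       a \<sqinter>\<^bsub>ea_order E\<^esub> (b \<squnion>\<^bsub>ea_order E\<^esub> c)
       = (a \<sqinter>\<^bsub>ea_order E\<^esub> b) \<squnion>\<^bsub>ea_order E\<^esub> (a \<sqinter>\<^bsub>ea_order E\<^esub> c)) \<and>
    (\<forall>a\<in>carrier E. a \<sqinter>\<^bsub>ea_order E\<^esub> supp E a = ezero E \<and>
       a \<squnion>\<^bsub>ea_order E\<^esub> supp E a = eone E)"

definition total_operation :: "('a, 'm) ea_struct_scheme \<Rightarrow> ('a \<Rightarrow> 'a \<Rightarrow> 'a) \<Rightarrow> bool" where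
  "total_operation E f \<longleftrightarrow> (\<forall>a\<in>carrier E. \<forall>b\<in>carrier E. f a b \<in> carrier E)"

definition commutes :: "('a \<Rightarrow> 'a \<Rightarrow> 'a) \<Rightarrow> 'a \<Rightarrow> 'a \<Rightarrow> bool" where
  "commutes f a b \<longleftrightarrow> f a b = f b a"

text \<open>In \<open>axiom_S1\<close> the conclusion includes that the right-hand sum is defined.\<close>

definition axiom_S1 :: "('a, 'm) ea_struct_scheme \<Rightarrow> ('a \<Rightarrow> 'a \<Rightarrow> 'a) \<Rightarrow> bool" where
  "axiom_S1 E f \<longleftrightarrow> (\<forall>a\<in>carrier E. \<forall>b\<in>carrier E. \<forall>c\<in>carrier E. \<forall>d.
     osum E b c = Some d \<longrightarrow> osum E (f a b) (f a c) = Some (f a d))"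

definition axiom_S2 :: "('a, 'm) ea_struct_scheme \<Rightarrow> ('a \<Rightarrow> 'a \<Rightarrow> 'a) \<Rightarrow> bool" where
  "axiom_S2 E f \<longleftrightarrow> (\<forall>a\<in>carrier E. f (eone E) a = a)"

definition axiom_S3 :: "('a, 'm) ea_struct_scheme \<Rightarrow> ('a \<Rightarrow> 'a \<Rightarrow> 'a) \<Rightarrow> bool" where
  "axiom_S3 E f \<longleftrightarrow> (\<forall>a\<in>carrier E. \<forall>b\<in>carrier E.
     f a b = ezero E \<longrightarrow> f a b = f b a)"

definition axiom_S4 :: "('a, 'm) ea_struct_scheme \<Rightarrow> ('a \<Rightarrow> 'a \<Rightarrow> 'a) \<Rightarrow> bool" where
  "axiom_S4 E f \<longleftrightarrow> (\<forall>a\<in>carrier E. \<forall>b\<in>carrier E. commutes f a b \<longrightarrow>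
     commutes f a (supp E b) \<and> (\<forall>c\<in>carrier E. f a (f b c) = f (f a b) c))"

definition axiom_S5 :: "('a, 'm) ea_struct_scheme \<Rightarrow> ('a \<Rightarrow> 'a \<Rightarrow> 'a) \<Rightarrow> bool" where
  "axiom_S5 E f \<longleftrightarrow> (\<forall>a\<in>carrier E. \<forall>b\<in>carrier E. \<forall>c\<in>carrier E.
     commutes f c a \<and> commutes f c b \<longrightarrow>
     commutes f c (f a b) \<and> (\<forall>d. osum E a b = Some d \<longrightarrow> commutes f c d))"

definition S1_to_S3_operation :: "('a, 'm) ea_struct_scheme \<Rightarrow> ('a \<Rightarrow> 'a \<Rightarrow> 'a) \<Rightarrow> bool" where
  "S1_to_S3_operation E f \<longleftrightarrow>
    total_operation E f \<and> axiom_S1 E f \<and> axiom_S2 E f \<and> axiom_S3 E f"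

definition S1_to_S4_operation :: "('a, 'm) ea_struct_scheme \<Rightarrow> ('a \<Rightarrow> 'a \<Rightarrow> 'a) \<Rightarrow> bool" where
  "S1_to_S4_operation E f \<longleftrightarrow> S1_to_S3_operation E f \<and> axiom_S4 E f"

definition sequential_product :: "('a, 'm) ea_struct_scheme \<Rightarrow> ('a \<Rightarrow> 'a \<Rightarrow> 'a) \<Rightarrow> bool" where
  "sequential_product E f \<longleftrightarrow> S1_to_S4_operation E f \<and> axiom_S5 E f"

end

theory Submission
  imports Defs
begin

text \<open>
  If \<open>f\<close> satisfies (S1)--(S4), then \<open>a \<circ> 0 = 0\<close> by (S1), hence \<open>0 \<circ> a = 0\<close> by (S3), so \<open>a | 0\<close> and
  (S4) gives \<open>a | 1\<close>, that is \<open>a \<circ> 1 = a\<close>. Suppose \<open>a \<noteq> 0\<close>, \<open>a \<oplus> a\<close> is defined and \<open>e\<close> is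
  minimal with \<open>a \<circ> e \<noteq> 0\<close>. Then \<open>e \<circ> a \<noteq> 0\<close> by (S3), \<open>e \<circ> a \<le> e \<circ> 1 = e\<close>, and additivity of
  \<open>a \<circ> _\<close> together with minimality gives \<open>e \<circ> a = e\<close>. Hence
  \<open>e \<oplus> e = e \<circ> (a \<oplus> a) \<le> e \<circ> 1 = e\<close> and \<open>e = 0\<close>, which is absurd. So in a finite effect algebra
  with such an operation no nonzero element is orthogonal to itself, and Riesz decomposition makes
  the lattice Boolean. Conversely, the meet of a Boolean algebra is a sequential product, and
  \<open>a \<circ> b = b\<close> for \<open>a \<noteq> 0\<close>, \<open>0 \<circ> b = 0\<close> is an (S1)--(S3) operation on any effect algebra. In the
  three-element chain the middle element is orthogonal to itself.
\<close>

section \<open>The order and the notion of orthoalgebra\<close>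

lemma carrier_ea_order [simp]: "carrier (ea_order E) = carrier E"
  by (simp add: ea_order_def)

lemma eq_ea_order [simp]: "x .=\<^bsub>ea_order E\<^esub> y \<longleftrightarrow> x = y"
  by (simp add: ea_order_def)

lemma le_ea_order: "a \<sqsubseteq>\<^bsub>ea_order E\<^esub> b \<longleftrightarrow> (\<exists>c\<in>carrier E. osum E a c = Some b)"
  by (simp add: ea_order_def)

text \<open>The hinge of the equivalence: operations with (S1)--(S4) force this property, and Riesz
  decomposition on a lattice turns it into Booleanness.\<close>

definition orthoalgebra :: "('a, 'm) ea_struct_scheme \<Rightarrow> bool" where
  "orthoalgebra E \<longleftrightarrow>
    effect_algebra E \<and> (\<forall>a\<in>carrier E. perp E a a \<longrightarrow> a = ezero E)"

context effect_algebra
begin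

abbreviation below :: "'a \<Rightarrow> 'a \<Rightarrow> bool" (infix "\<preceq>" 50) where
  "a \<preceq> b \<equiv> a \<sqsubseteq>\<^bsub>ea_order E\<^esub> b"

section \<open>Partial sums: supplements, zero, cancellation, positivity\<close>

lemma osum_commute:
  assumes "a \<in> carrier E" "b \<in> carrier E"
  shows "osum E a b = osum E b a"
  using osum_comm[of a b] osum_comm[of b a] assms unfolding perp_def by metis

lemma assoc_right:
  assumes "a \<in> carrier E" "b \<in> carrier E" "c \<in> carrier E"
    and "osum E a b = Some d" "osum E d c = Some e"
  obtains f where "f \<in> carrier E" "osum E b c = Some f" "osum E a f = Some e"
proof -
  have "Option.bind (osum E b c) (\<lambda>f. osum E a f) = Some e"
    using osum_assoc[OF assms(1,2,3)] by (simp add: assms(4,5))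
  then show ?thesis
    using that osum_closed[OF assms(2,3)] unfolding bind_eq_Some_conv by blast
qed

lemma
  assumes "a \<in> carrier E"
  shows supp_closed: "supp E a \<in> carrier E"
    and osum_supp: "osum E a (supp E a) = Some (eone E)"
  using theI'[OF ex1_supp[OF assms]] by (auto simp: supp_def)

lemma supp_unique:
  assumes "a \<in> carrier E" "b \<in> carrier E" "osum E a b = Some (eone E)"
  shows "supp E a = b"
  using ex1_supp[OF assms(1)] assms supp_closed osum_supp by blast

lemma supp_supp: "a \<in> carrier E \<Longrightarrow> supp E (supp E a) = a"
  using supp_unique[of "supp E a" a] osum_supp[of a] supp_closed[of a]
  by (simp add: osum_commute[of "supp E a"])

lemma supp_one: "supp E (eone E) = ezero E"
  using osum_supp[OF one_closed] supp_closed[OF one_closed] one_closed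
  by (intro perp_one) (simp_all add: perp_def osum_commute[of "supp E (eone E)"])

lemma supp_zero: "supp E (ezero E) = eone E"
  using supp_supp[OF one_closed] by (simp add: supp_one)

text \<open>Reassociating \<open>(a' \<oplus> a) \<oplus> 0 = 1\<close> makes
  \<open>a \<oplus> 0\<close> a supplement of \<open>a'\<close>, and the supplement of
  \<open>a'\<close> is \<open>a\<close>.\<close>

lemma osum_zero_right:
  assumes "a \<in> carrier E"
  shows "osum E a (ezero E) = Some a"
proof -
  let ?b = "supp E a"
  have b: "?b \<in> carrier E" "osum E ?b a = Some (eone E)"
    using supp_closed[OF assms] osum_supp[OF assms] assms
    by (simp_all add: osum_commute[of "supp E a"])
  have "osum E (eone E) (ezero E) = Some (eone E)"
    using osum_supp[OF one_closed] by (simp add: supp_one)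
  then obtain f where f: "f \<in> carrier E" "osum E a (ezero E) = Some f"
      "osum E ?b f = Some (eone E)"
    using assoc_right[OF b(1) assms zero_closed b(2)] by metis
  then show ?thesis
    using supp_unique[OF b(1) f(1,3)] assms by (simp add: supp_supp)
qed

lemma osum_zero_left: "a \<in> carrier E \<Longrightarrow> osum E (ezero E) a = Some a"
  using osum_zero_right osum_commute zero_closed by metis

lemma osum_cancel_left:
  assumes "a \<in> carrier E" "b \<in> carrier E" "c \<in> carrier E"
    and "osum E a b = Some d" "osum E a c = Some d"
  shows "b = c"
proof -
  have d: "d \<in> carrier E"
    using assms osum_closed by blast
  \<comment> \<open>From \<open>x \<oplus> a = d\<close> follows
    \<open>x \<oplus> (a \<oplus> d') = 1\<close>, so \<open>x'\<close> is
    \<open>a \<oplus> d'\<close>, which depends only on \<open>a\<close> and \<open>d\<close>. The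
    outer supplement recovers \<open>x\<close>.\<close>
  have *: "supp E (supp E x) = supp E (the (osum E a (supp E d)))"
    if x: "x \<in> carrier E" "osum E a x = Some d" for x
  proof -
    have "osum E x a = Some d"
      using x assms(1) osum_commute by metis
    then obtain f where f: "f \<in> carrier E" "osum E a (supp E d) = Some f"
        "osum E x f = Some (eone E)"
      using assoc_right[OF x(1) assms(1) supp_closed[OF d] _ osum_supp[OF d]] by metis
    then show ?thesis
      using supp_unique[OF x(1) f(1,3)] by simp
  qed
  show ?thesis
    using *[of b] *[of c] assms by (simp add: supp_supp)
qed

text \<open>Since \<open>(b \<oplus> a) \<oplus> 1 = 0 \<oplus> 1\<close> is defined, so is
  \<open>a \<oplus> 1\<close>, and \<open>perp_one\<close> applies.\<close>

lemma osum_eq_zero: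
  assumes "a \<in> carrier E" "b \<in> carrier E" "osum E a b = Some (ezero E)"
  shows "a = ezero E"
proof -
  have "osum E b a = Some (ezero E)"
    using assms osum_commute by metis
  then obtain f where "osum E a (eone E) = Some f"
    using assoc_right[OF assms(2,1) one_closed _ osum_zero_left[OF one_closed]] by metis
  then show ?thesis
    using assms perp_one by (auto simp: perp_def)
qed

lemma osum_eq_left:
  assumes "a \<in> carrier E" "b \<in> carrier E" "osum E a b = Some a"
  shows "b = ezero E"
  using osum_cancel_left[OF assms(1,2) zero_closed assms(3)] osum_zero_right assms by blast

lemma below_osum_left:
  assumes "a \<in> carrier E" "b \<in> carrier E" "osum E a b = Some c"
  shows "a \<preceq> c"
  using assms by (auto simp: le_ea_order)

lemma below_osum_right:
  assumes "a \<in> carrier E" "b \<in> carrier E" "osum E a b = Some c"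
  shows "b \<preceq> c"
  using below_osum_left[OF assms(2,1)] assms(3) by (simp add: osum_commute[OF assms(1,2)])

section \<open>The induced order and orthogonality\<close>

text \<open>Transitivity is associativity. For antisymmetry,
  \<open>x \<oplus> (u \<oplus> v) = x\<close> gives \<open>u \<oplus> v = 0\<close> by cancellation
  and \<open>u = 0\<close> by positivity.\<close>

lemma partial_order_ea_order: "partial_order (ea_order E)"
proof
  fix x y z
  assume "x \<preceq> y" "y \<preceq> z" and "x \<in> carrier (ea_order E)"
  then obtain u v where uv: "u \<in> carrier E" "osum E x u = Some y"
      "v \<in> carrier E" "osum E y v = Some z" and x: "x \<in> carrier E"
    by (auto simp: le_ea_order)
  obtain f where "f \<in> carrier E" "osum E x f = Some z"
    by (rule assoc_right[OF x uv(1,3,2,4)])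
  then show "x \<preceq> z"
    by (auto simp: le_ea_order)
next
  fix x y
  assume "x \<preceq> y" "y \<preceq> x" and "x \<in> carrier (ea_order E)"
  then obtain u v where uv: "u \<in> carrier E" "osum E x u = Some y"
      "v \<in> carrier E" "osum E y v = Some x" and x: "x \<in> carrier E"
    by (auto simp: le_ea_order)
  obtain f where f: "f \<in> carrier E" "osum E u v = Some f" "osum E x f = Some x"
    by (rule assoc_right[OF x uv(1,3,2,4)])
  then have "osum E u v = Some (ezero E)"
    using osum_eq_left[OF x] by simp
  then have "u = ezero E"
    by (rule osum_eq_zero[OF uv(1,3)])
  then show "x .=\<^bsub>ea_order E\<^esub> y"
    using uv x by (simp add: osum_zero_right)
next
  fix x
  assume "x \<in> carrier (ea_order E)"
  then show "x \<preceq> x"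
    using osum_zero_right zero_closed by (auto simp: le_ea_order)
qed (auto simp: ea_order_def)

sublocale PO: partial_order "ea_order E"
  by (rule partial_order_ea_order)

lemma below_one: "a \<in> carrier E \<Longrightarrow> a \<preceq> eone E"
  using osum_supp supp_closed by (auto simp: le_ea_order)

lemma below_zero: "\<lbrakk>a \<in> carrier E; a \<preceq> ezero E\<rbrakk> \<Longrightarrow> a = ezero E"
  by (auto simp: le_ea_order intro: osum_eq_zero)

lemma osum_mono:
  assumes c: "a \<in> carrier E" "b \<in> carrier E" "c \<in> carrier E"
    and "a \<preceq> b" "osum E b c = Some d"
  obtains e where "e \<in> carrier E" "osum E a c = Some e" "e \<preceq> d"
proof -
  obtain u where u: "u \<in> carrier E" "osum E a u = Some b"
    using \<open>a \<preceq> b\<close> by (auto simp: le_ea_order)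
  then have "osum E u a = Some b"
    using osum_commute c by metis
  then obtain f where "f \<in> carrier E" "osum E a c = Some f" "osum E u f = Some d"
    using assoc_right[OF u(1) c(1,3) _ assms(5)] by metis
  then show ?thesis
    using that u(1) below_osum_right by blast
qed

lemma perp_mono:
  assumes "a \<in> carrier E" "b \<in> carrier E" "c \<in> carrier E" "d \<in> carrier E"
    and "a \<preceq> b" "c \<preceq> d" "perp E b d"
  shows "perp E a c"
proof -
  obtain e where "osum E b d = Some e"
    using assms by (auto simp: perp_def)
  then obtain f where "osum E a d = Some f"
    using osum_mono assms by metis
  then have "osum E d a = Some f"
    using osum_commute assms by metis
  then obtain g where "osum E c a = Some g"
    using osum_mono assms by metis
  then show ?thesis
    using osum_commute[of a c] assms by (simp add: perp_def)
qed

text \<open>With \<open>c = b \<oplus> a\<close>, reassociating \<open>c \<oplus> c' = 1\<close>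
  shows \<open>b' = a \<oplus> c'\<close>. The converse is monotonicity of orthogonality.\<close>

lemma perp_iff_below_supp:
  assumes "a \<in> carrier E" "b \<in> carrier E"
  shows "perp E a b \<longleftrightarrow> a \<preceq> supp E b"
proof
  assume "perp E a b"
  then obtain c where c: "osum E b a = Some c" "c \<in> carrier E"
    using assms osum_commute[of a b] osum_closed[of a b] by (auto simp: perp_def)
  obtain f where "f \<in> carrier E" "osum E a (supp E c) = Some f" "osum E b f = Some (eone E)"
    using assoc_right[OF assms(2,1) supp_closed[OF c(2)] c(1) osum_supp[OF c(2)]] by metis
  then show "a \<preceq> supp E b"
    using supp_unique[OF assms(2)] assms(1) supp_closed[OF c(2)] below_osum_left by metis
next
  assume "a \<preceq> supp E b"
  moreover have "perp E (supp E b) b"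
    using osum_supp[OF assms(2)] osum_commute[OF assms(2) supp_closed[OF assms(2)]]
    by (simp add: perp_def)
  ultimately show "perp E a b"
    using assms perp_mono[of a "supp E b" b b] supp_closed by simp
qed

section \<open>Orthoalgebras with Riesz decomposition are Boolean\<close>

text \<open>A common lower bound of orthogonal elements is orthogonal to itself.\<close>

lemma orthoalgebra_disjoint:
  assumes "orthoalgebra E" "perp E x y" "z \<preceq> x" "z \<preceq> y"
    "x \<in> carrier E" "y \<in> carrier E" "z \<in> carrier E"
  shows "z = ezero E"
  using assms perp_mono[of z x z y] by (auto simp: orthoalgebra_def)

text \<open>In a lattice the orthogonal sum of an orthoalgebra is the join; in general it is only a
  minimal upper bound.\<close>

lemma orthoalgebra_osum_below:
  assumes "orthoalgebra E" "lattice (ea_order E)" "osum E b c = Some s" "b \<preceq> d" "c \<preceq> d"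
    and carr: "b \<in> carrier E" "c \<in> carrier E" "d \<in> carrier E"
  shows "s \<preceq> d"
proof -
  interpret lattice "ea_order E" by fact
  let ?j = "b \<squnion>\<^bsub>ea_order E\<^esub> c"
  have s: "s \<in> carrier E" and j: "?j \<in> carrier E"
    using osum_closed[OF carr(1,2) assms(3)] join_closed[of b c] carr by simp_all
  have "b \<preceq> s" "c \<preceq> s"
    using below_osum_left below_osum_right carr(1,2) assms(3) by blast+
  then have "b \<preceq> ?j" "c \<preceq> ?j" "?j \<preceq> s" "?j \<preceq> d"
    using join_left[of b c] join_right[of b c] join_le[of b s c] join_le[of b d c] s carr assms(4,5)
    by simp_all
  \<comment> \<open>The gap \<open>e\<close> between the join and \<open>s\<close> must vanish.
    Cancelling \<open>b\<close> and \<open>c\<close> in turn yields \<open>c = x \<oplus> e\<close>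
    and \<open>b = y \<oplus> e\<close>, so \<open>e\<close> lies below two orthogonal
    elements.\<close>
  then obtain e x y where e: "e \<in> carrier E" "osum E ?j e = Some s"
    and x: "x \<in> carrier E" "osum E b x = Some ?j"
    and y: "y \<in> carrier E" "osum E c y = Some ?j"
    unfolding le_ea_order by blast
  have cb: "osum E c b = Some s"
    using assms(3) osum_commute[OF carr(1,2)] by simp
  obtain f where f: "f \<in> carrier E" "osum E x e = Some f" "osum E b f = Some s"
    using assoc_right[OF carr(1) x(1) e(1) x(2) e(2)] by metis
  have ec: "e \<preceq> c"
    using osum_cancel_left[OF carr(1) f(1) carr(2) f(3) assms(3)]
      below_osum_right[OF x(1) e(1) f(2)] by simp
  obtain g where g: "g \<in> carrier E" "osum E y e = Some g" "osum E c g = Some s"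
    using assoc_right[OF carr(2) y(1) e(1) y(2) e(2)] by metis
  have eb: "e \<preceq> b"
    using osum_cancel_left[OF carr(2) g(1) carr(1) g(3) cb]
      below_osum_right[OF y(1) e(1) g(2)] by simp
  have "e = ezero E"
    using orthoalgebra_disjoint[OF assms(1) _ eb ec carr(1,2) e(1)] assms(3)
    by (simp add: perp_def)
  then have "s = ?j"
    using e osum_zero_right[OF j] by simp
  then show ?thesis
    using \<open>?j \<preceq> d\<close> by simp
qed

lemma orthoalgebra_riesz_imp_boolean:
  assumes oa: "orthoalgebra E" and lat: "lattice (ea_order E)" and rd: "riesz_decomposition E"
  shows "boolean_effect_algebra E"
proof -
  interpret lattice "ea_order E" by fact
  let ?m = "\<lambda>x y. x \<sqinter>\<^bsub>ea_order E\<^esub> y" and ?j = "\<lambda>x y. x \<squnion>\<^bsub>ea_order E\<^esub> y"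
  have mc: "?m x y \<in> carrier E" and jc: "?j x y \<in> carrier E"
    if "x \<in> carrier E" "y \<in> carrier E" for x y
    using that meet_closed[of x y] join_closed[of x y] by simp_all
  have riesz: "\<exists>y\<in>carrier E. \<exists>z\<in>carrier E. y \<preceq> b \<and> z \<preceq> c \<and> osum E y z = Some x"
    if "osum E b c = Some d" "x \<preceq> d" "x \<in> carrier E" "b \<in> carrier E" "c \<in> carrier E" for b c d x
    using rd that unfolding riesz_decomposition_def by blast
  have dist: "?m a (?j b c) = ?j (?m a b) (?m a c)"
    if carr: "a \<in> carrier E" "b \<in> carrier E" "c \<in> carrier E" for a b c
  proof (rule PO.le_antisym)
    let ?x = "?m a (?j b c)" and ?r = "?j (?m a b) (?m a c)"
    show xr: "?x \<in> carrier (ea_order E)" "?r \<in> carrier (ea_order E)"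
      using carr mc jc by simp_all
    \<comment> \<open>Riesz decomposition of \<open>c \<le> b \<oplus> b'\<close> isolates a part
      \<open>c2\<close> of \<open>c\<close> orthogonal to \<open>b\<close>. Then
      \<open>b \<oplus> c2\<close> bounds both \<open>b\<close> and \<open>c\<close>, so an
      orthogonal sum can stand in for their join.\<close>
    obtain c1 c2 where c12: "c1 \<in> carrier E" "c2 \<in> carrier E" "c1 \<preceq> b" "c2 \<preceq> supp E b"
        "osum E c1 c2 = Some c"
      using riesz[OF osum_supp[OF carr(2)] below_one[OF carr(3)] carr(3,2) supp_closed[OF carr(2)]]
      by blast
    have "perp E c2 b"
      using c12 carr perp_iff_below_supp by blast
    then obtain s where s: "osum E b c2 = Some s" "s \<in> carrier E"
      using osum_commute[OF carr(2) c12(2)] osum_closed[OF carr(2) c12(2)]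
      by (auto simp: perp_def)
    have "c \<preceq> s"
      using osum_mono[OF c12(1) carr(2) c12(2,3) s(1)] c12(5) by auto
    moreover have "b \<preceq> s"
      using s carr c12 below_osum_left by blast
    ultimately have "?j b c \<preceq> s"
      using join_le[of b s c] carr s by simp
    then have "?x \<preceq> s"
      using meet_right[of a "?j b c"] carr jc mc s PO.le_trans[of ?x "?j b c" s] by simp
    \<comment> \<open>A second decomposition splits the meet itself. Its parts lie below
      \<open>a\<close> and below \<open>b\<close> or \<open>c\<close> respectively, hence below the
      meets on the right, and their sum stays below every common upper bound.\<close>
    then obtain x1 x2 where x12: "x1 \<in> carrier E" "x2 \<in> carrier E" "x1 \<preceq> b" "x2 \<preceq> c2"
        "osum E x1 x2 = Some ?x"
      using riesz[OF s(1) _ _ carr(2) c12(2), of ?x] xr unfolding carrier_ea_order by blast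
    have "x2 \<preceq> c"
      using x12 c12 below_osum_right[OF c12(1,2,5)] carr PO.le_trans[of x2 c2 c] by simp
    have xa: "?x \<preceq> a"
      using meet_left[of a "?j b c"] carr jc by simp
    have "x1 \<preceq> a" "x2 \<preceq> a"
      using x12 below_osum_left[OF x12(1,2,5)] below_osum_right[OF x12(1,2,5)] xa xr carr
        PO.le_trans[of x1 ?x a] PO.le_trans[of x2 ?x a] by simp_all
    then have "x1 \<preceq> ?m a b" "x2 \<preceq> ?m a c"
      using meet_le[of x1 a b] meet_le[of x2 a c] x12 \<open>x2 \<preceq> c\<close> carr by simp_all
    moreover have "?m a b \<preceq> ?r" "?m a c \<preceq> ?r"
      using join_left[of "?m a b" "?m a c"] join_right[of "?m a b" "?m a c"] mc carr by simp_all
    ultimately have "x1 \<preceq> ?r" "x2 \<preceq> ?r"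
      using PO.le_trans[of x1 "?m a b" ?r] PO.le_trans[of x2 "?m a c" ?r] x12 xr mc carr
      by simp_all
    then show "?x \<preceq> ?r"
      using orthoalgebra_osum_below[OF oa lat x12(5)] x12 xr by simp
    \<comment> \<open>The reverse inequality holds in every lattice.\<close>
    have "?m a b \<preceq> ?x"
      using carr mc jc meet_left[of a b] meet_right[of a b] join_left[of b c]
        PO.le_trans[of "?m a b" b "?j b c"] by (intro meet_le) simp_all
    moreover have "?m a c \<preceq> ?x"
      using carr mc jc meet_left[of a c] meet_right[of a c] join_right[of b c]
        PO.le_trans[of "?m a c" c "?j b c"] by (intro meet_le) simp_all
    ultimately show "?r \<preceq> ?x"
      using carr mc xr by (intro join_le) simp_all
  qed
  have compl: "?m a (supp E a) = ezero E" "?j a (supp E a) = eone E" if a: "a \<in> carrier E" for a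
  proof -
    note a' = supp_closed[OF a]
    have p: "perp E a (supp E a)"
      using osum_supp[OF a] by (simp add: perp_def)
    show "?m a (supp E a) = ezero E"
      using orthoalgebra_disjoint[OF oa p] meet_left[of a "supp E a"] meet_right[of a "supp E a"]
        mc a a' by simp
    \<comment> \<open>\<open>1 = a \<oplus> a'\<close> is below every upper bound of
      \<open>a\<close> and \<open>a'\<close>.\<close>
    have "eone E \<preceq> ?j a (supp E a)"
      using orthoalgebra_osum_below[OF oa lat osum_supp[OF a]] a a' jc
        join_left[of a "supp E a"] join_right[of a "supp E a"] by simp
    then show "?j a (supp E a) = eone E"
      using below_one jc a a' one_closed PO.le_antisym[of "?j a (supp E a)" "eone E"] by simp
  qed
  show ?thesis
    unfolding boolean_effect_algebra_def
    using effect_algebra_axioms lat dist compl by simp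
qed

text \<open>A self-orthogonal \<open>a\<close> is below \<open>a'\<close>, hence below the meet of
  \<open>a\<close> and \<open>a'\<close>, which is zero.\<close>

lemma boolean_imp_orthoalgebra:
  assumes "boolean_effect_algebra E"
  shows "orthoalgebra E"
  unfolding orthoalgebra_def
proof (intro conjI ballI impI)
  interpret lattice "ea_order E"
    using assms by (simp add: boolean_effect_algebra_def)
  fix a assume a: "a \<in> carrier E" "perp E a a"
  then have "a \<preceq> a \<sqinter>\<^bsub>ea_order E\<^esub> supp E a"
    using perp_iff_below_supp[of a a] supp_closed meet_le[of a a "supp E a"] by simp
  then show "a = ezero E"
    using assms a below_zero by (simp add: boolean_effect_algebra_def)
qed (rule effect_algebra_axioms)

section \<open>Constructing operations\<close>

text \<open>Commutativity of the meet settles (S3), (S5) and the commutation half of (S4); the other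
  half is associativity. Orthogonal sums are joins, so (S1) is distributivity.\<close>

lemma boolean_imp_sequential_product:
  assumes bool: "boolean_effect_algebra E"
  shows "sequential_product E (\<lambda>a b. a \<sqinter>\<^bsub>ea_order E\<^esub> b)"
proof -
  have lat: "lattice (ea_order E)"
    using bool by (simp add: boolean_effect_algebra_def)
  then interpret lattice "ea_order E" .
  let ?m = "\<lambda>x y. x \<sqinter>\<^bsub>ea_order E\<^esub> y" and ?j = "\<lambda>x y. x \<squnion>\<^bsub>ea_order E\<^esub> y"
  note oa = boolean_imp_orthoalgebra[OF bool]
  have mc: "?m x y \<in> carrier E" and jc: "?j x y \<in> carrier E"
    if "x \<in> carrier E" "y \<in> carrier E" for x y
    using that meet_closed[of x y] join_closed[of x y] by simp_all
  have osum_join: "d = ?j b c"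
    if bc: "osum E b c = Some d" "b \<in> carrier E" "c \<in> carrier E" for b c d
  proof (rule PO.le_antisym)
    show "d \<preceq> ?j b c"
      using orthoalgebra_osum_below[OF oa lat bc(1)] bc jc join_left[of b c] join_right[of b c]
      by simp
    show "?j b c \<preceq> d"
      using bc below_osum_left[OF bc(2,3,1)] below_osum_right[OF bc(2,3,1)]
        osum_closed[OF bc(2,3,1)] join_le[of b d c] by simp
  qed (use bc jc osum_closed[OF bc(2,3,1)] in simp_all)
  have S1: "osum E (?m a b) (?m a c) = Some (?m a d)"
    if carr: "a \<in> carrier E" "b \<in> carrier E" "c \<in> carrier E" and d: "osum E b c = Some d"
    for a b c d
  proof -
    \<comment> \<open>Definedness comes first: the meets lie below the orthogonal elements
      \<open>b\<close> and \<open>c\<close>.\<close>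
    have "perp E (?m a b) (?m a c)"
      using perp_mono[of "?m a b" b "?m a c" c] meet_right[of a b] meet_right[of a c] carr d mc
      by (simp add: perp_def)
    then obtain e where e: "osum E (?m a b) (?m a c) = Some e"
      by (auto simp: perp_def)
    have "e = ?j (?m a b) (?m a c)"
      using osum_join[OF e] mc carr by simp
    also have "\<dots> = ?m a d"
      using osum_join[OF d] carr bool by (simp add: boolean_effect_algebra_def)
    finally show ?thesis
      using e by simp
  qed
  have assoc: "?m a (?m b c) = ?m (?m a b) c"
    if "a \<in> carrier E" "b \<in> carrier E" "c \<in> carrier E" for a b c
    using weak_meet_assoc[of a b c] that by simp
  have one: "?m (eone E) a = a" if a: "a \<in> carrier E" for a
    using PO.le_antisym[of "?m (eone E) a" a] meet_right[of "eone E" a]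
      meet_le[of a "eone E" a] a one_closed mc below_one by simp
  have comm: "commutes ?m a b" for a b
    by (simp add: commutes_def meet_comm)
  have "total_operation E ?m" "axiom_S2 E ?m"
    by (simp_all add: total_operation_def axiom_S2_def mc one)
  moreover have "axiom_S1 E ?m"
    unfolding axiom_S1_def using S1 by blast
  moreover have "axiom_S3 E ?m"
    unfolding axiom_S3_def using comm unfolding commutes_def by blast
  moreover have "axiom_S4 E ?m"
    unfolding axiom_S4_def using comm assoc by blast
  moreover have "axiom_S5 E ?m"
    unfolding axiom_S5_def using comm by blast
  ultimately show ?thesis
    by (simp add: sequential_product_def S1_to_S4_operation_def S1_to_S3_operation_def)
qed

text \<open>Each left multiplication is the identity or the zero map, hence additive. A product
  vanishes only if a factor is zero, and then both products vanish.\<close>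

lemma S1_to_S3_operation_if_zero:
  "S1_to_S3_operation E (\<lambda>a b. if a = ezero E then ezero E else b)"
    (is "S1_to_S3_operation E ?f")
proof -
  \<comment> \<open>In the degenerate case \<open>1 = 0\<close> the product
    \<open>1 \<circ> a\<close> is zero, so (S2) requires the algebra to be trivial.\<close>
  have "ezero E = a" if "a \<in> carrier E" "eone E = ezero E" for a
    using perp_one[OF that(1)] osum_zero_right[OF that(1)] that(2) by (simp add: perp_def)
  then have "axiom_S2 E ?f"
    by (auto simp: axiom_S2_def)
  moreover have "total_operation E ?f" "axiom_S1 E ?f" "axiom_S3 E ?f"
    by (simp_all add: total_operation_def axiom_S1_def axiom_S3_def zero_closed
        osum_zero_left[OF zero_closed])
  ultimately show ?thesis
    by (simp add: S1_to_S3_operation_def)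
qed

section \<open>Operations with (S1)--(S4) force an orthoalgebra\<close>

text \<open>Passing to a smaller witness strictly shrinks the finite down-set, because antisymmetry
  removes the old witness from it.\<close>

lemma finite_minimal:
  assumes "finite (carrier E)" "x \<in> carrier E" "P x"
  obtains e where "e \<in> carrier E" "P e"
    "\<And>y. \<lbrakk>y \<in> carrier E; P y; y \<preceq> e\<rbrakk> \<Longrightarrow> y = e"
proof -
  let ?A = "\<lambda>e. {y \<in> carrier E. y \<preceq> e}"
  have "\<exists>e. e \<in> carrier E \<and> P e \<and> (\<forall>y. y \<in> carrier E \<and> P y \<and> y \<preceq> e \<longrightarrow> y = e)"
    using assms(2,3)
  proof (induction "card (?A x)" arbitrary: x rule: less_induct)
    case less
    show ?case
    proof (cases "\<exists>y. y \<in> carrier E \<and> P y \<and> y \<preceq> x \<and> y \<noteq> x")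
      case False
      then show ?thesis
        using less.prems by (intro exI[of _ x]) auto
    next
      case True
      then obtain y where y: "y \<in> carrier E" "P y" "y \<preceq> x" "y \<noteq> x"
        by blast
      have "x \<notin> ?A y"
        using PO.le_antisym[of x y] y less.prems by auto
      moreover have "?A y \<subseteq> ?A x"
        using PO.le_trans[of _ y x] y less.prems by auto
      ultimately have "?A y \<subset> ?A x"
        using less.prems PO.le_refl[of x] by auto
      then have "card (?A y) < card (?A x)"
        using assms(1) by (intro psubset_card_mono) auto
      then show ?thesis
        using less.hyps[of y] y by blast
    qed
  qed
  then show ?thesis
    using that by blast
qed

lemma S1_to_S4_imp_orthoalgebra:
  assumes fin: "finite (carrier E)" and f: "S1_to_S4_operation E f"
  shows "orthoalgebra E"
proof -
  let ?z = "ezero E"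
  have fc: "f a b \<in> carrier E" if "a \<in> carrier E" "b \<in> carrier E" for a b
    using f that
    by (simp add: S1_to_S4_operation_def S1_to_S3_operation_def total_operation_def)
  have S1: "osum E (f a b) (f a c) = Some (f a d)"
    if "a \<in> carrier E" "b \<in> carrier E" "c \<in> carrier E" "osum E b c = Some d" for a b c d
    using f that unfolding S1_to_S4_operation_def S1_to_S3_operation_def axiom_S1_def by blast
  have S2: "f (eone E) a = a" if "a \<in> carrier E" for a
    using f that by (simp add: S1_to_S4_operation_def S1_to_S3_operation_def axiom_S2_def)
  have S3: "f b a = ?z" if "a \<in> carrier E" "b \<in> carrier E" "f a b = ?z" for a b
    using f that by (simp add: S1_to_S4_operation_def S1_to_S3_operation_def axiom_S3_def)
  have S4: "f a (supp E b) = f (supp E b) a"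
    if "a \<in> carrier E" "b \<in> carrier E" "f a b = f b a" for a b
    using f that by (simp add: S1_to_S4_operation_def axiom_S4_def commutes_def)
  have f_zero: "f a ?z = ?z" if a: "a \<in> carrier E" for a
    using S1[OF a zero_closed zero_closed osum_zero_left[OF zero_closed]] fc[OF a zero_closed]
      osum_eq_left by blast
  \<comment> \<open>This is where (S4) enters: \<open>a\<close> commutes with \<open>0\<close>,
    hence with its supplement \<open>1\<close>, and (S2) evaluates the product.\<close>
  have f_one: "f a (eone E) = a" if a: "a \<in> carrier E" for a
    using S4[OF a zero_closed] f_zero[OF a] S3[OF a zero_closed] S2[OF a]
    by (simp add: supp_zero)
  have f_mono: "f a b \<preceq> f a c"
    if "a \<in> carrier E" "b \<in> carrier E" "b \<preceq> c" for a b c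
  proof -
    obtain d where "d \<in> carrier E" "osum E b d = Some c"
      using \<open>b \<preceq> c\<close> by (auto simp: le_ea_order)
    then show ?thesis
      using below_osum_left[OF fc fc S1] that by blast
  qed
  have f_below: "f a b \<preceq> a" if "a \<in> carrier E" "b \<in> carrier E" for a b
    using f_mono[OF that below_one[OF that(2)]] f_one that by simp
  have "a = ?z" if aa: "a \<in> carrier E" "perp E a a" for a
  proof (rule ccontr)
    assume "a \<noteq> ?z"
    with aa have a: "a \<in> carrier E" "a \<noteq> ?z"
      by simp_all
    obtain d where d: "osum E a a = Some d" "d \<in> carrier E"
      using osum_closed[OF aa(1,1)] aa(2) by (auto simp: perp_def)
    have "f a (eone E) \<noteq> ?z"
      using f_one a by simp
    then obtain e where e: "e \<in> carrier E" "f a e \<noteq> ?z"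
      and min: "\<And>y. \<lbrakk>y \<in> carrier E; f a y \<noteq> ?z; y \<preceq> e\<rbrakk> \<Longrightarrow> y = e"
      using finite_minimal[OF fin one_closed, of "\<lambda>y. f a y \<noteq> ?z"] by blast
    have "f e a \<preceq> e"
      using f_below e a by blast
    then obtain y where y: "y \<in> carrier E" "osum E (f e a) y = Some e"
      by (auto simp: le_ea_order)
    \<comment> \<open>Otherwise \<open>a\<close> annihilates both summands of
      \<open>e = f e a \<oplus> y\<close>: the first by minimality; the second because
      \<open>y = e\<close> would give \<open>f e a = 0\<close>, against (S3). By (S1)
      \<open>a\<close> would annihilate \<open>e\<close>.\<close>
    have "f e a = e"
    proof (rule ccontr)
      assume ne: "f e a \<noteq> e"
      then have "f a (f e a) = ?z"
        using min[OF fc[OF e(1) a(1)]] \<open>f e a \<preceq> e\<close> by blast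
      moreover have "f a y = ?z"
      proof (rule ccontr)
        assume "f a y \<noteq> ?z"
        then have "osum E e (f e a) = Some e"
          using min[OF y(1)] below_osum_right[OF fc[OF e(1) a(1)] y]
            osum_commute[OF e(1) fc[OF e(1) a(1)]] y(2) by simp
        then have "f e a = ?z"
          by (rule osum_eq_left[OF e(1) fc[OF e(1) a(1)]])
        then show False
          using S3[OF e(1) a(1)] e(2) by simp
      qed
      ultimately have "f a e = ?z"
        using S1[OF a(1) fc[OF e(1) a(1)] y] osum_zero_left[OF zero_closed] by simp
      then show False
        using e by simp
    qed
    \<comment> \<open>(S1) for \<open>d = a \<oplus> a\<close> gives
      \<open>e \<oplus> e = f e d \<le> e\<close>, so \<open>e \<oplus> e = e\<close>.\<close>
    then have "osum E e e = Some (f e d)"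
      using S1[OF e(1) a(1) a(1) d(1)] by simp
    moreover from this have "e \<preceq> f e d"
      by (rule below_osum_left[OF e(1,1)])
    ultimately have "osum E e e = Some e"
      using PO.le_antisym[of e "f e d"] f_below[OF e(1) d(2)] e(1) fc[OF e(1) d(2)] by simp
    then have "e = ?z"
      by (rule osum_eq_left[OF e(1,1)])
    then show False
      using f_zero[OF a(1)] e(2) by simp
  qed
  then show ?thesis
    using effect_algebra_axioms by (simp add: orthoalgebra_def)
qed

end

section \<open>The three-element chain\<close>

text \<open>The algebra \<open>E_u\<close> with \<open>r = 1\<close> and \<open>u = 2\<close>, the
  smallest non-Boolean finite MV-effect algebra.\<close>

definition chain3 :: "nat ea_struct" where
  "chain3 = \<lparr>carrier = {..2}, osum = (\<lambda>a b. if a + b \<le> 2 then Some (a + b) else None),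
     ezero = 0, eone = 2\<rparr>"

lemma chain3_simps [simp]:
  "carrier chain3 = {..2}"
  "osum chain3 a b = (if a + b \<le> 2 then Some (a + b) else None)"
  "ezero chain3 = 0"
  "eone chain3 = 2"
  by (simp_all add: chain3_def)

lemma effect_algebra_chain3: "effect_algebra chain3"
proof
  fix a assume "a \<in> carrier chain3"
  then show "\<exists>!b. b \<in> carrier chain3 \<and> osum chain3 a b = Some (eone chain3)"
    by (intro ex1I[of _ "2 - a"]) (auto split: if_splits)
qed (auto simp: perp_def split: if_splits)

lemma le_chain3:
  assumes "b \<le> 2"
  shows "a \<sqsubseteq>\<^bsub>ea_order chain3\<^esub> b \<longleftrightarrow> a \<le> b"
  using assms by (auto simp: le_ea_order intro!: bexI[of _ "b - a"] split: if_splits)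

lemma finite_MV_chain3: "finite_MV_effect_algebra chain3"
  unfolding finite_MV_effect_algebra_def
proof (intro conjI)
  interpret effect_algebra chain3
    by (rule effect_algebra_chain3)
  show "effect_algebra chain3"
    by (rule effect_algebra_chain3)
  show "finite (carrier chain3)"
    by simp
  \<comment> \<open>Linearity already makes the order a lattice.\<close>
  interpret total_order "ea_order chain3"
    by unfold_locales (auto simp: le_chain3)
  show "lattice (ea_order chain3)"
    by (rule lattice_axioms)
  have *: "\<exists>y\<in>{..2}. \<exists>z\<in>{..2}. y \<le> b \<and> z \<le> c \<and> y + z = a"
    if "a \<le> b + c" "b + c \<le> 2" for a b c :: nat
    \<comment> \<open>Greedy splitting: as much of \<open>a\<close> as fits comes from
      \<open>b\<close>, and the rest fits in \<open>c\<close>.\<close>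
    using that by (intro bexI[of _ "min a b"] bexI[of _ "a - min a b"]) auto
  show "riesz_decomposition chain3"
    unfolding riesz_decomposition_def
  proof (intro ballI allI impI, elim conjE)
    fix a b c d
    assume "b \<in> carrier chain3" "c \<in> carrier chain3" "osum chain3 b c = Some d"
      "a \<sqsubseteq>\<^bsub>ea_order chain3\<^esub> d"
    then have bc: "b \<le> 2" "c \<le> 2" "a \<le> b + c" "b + c \<le> 2"
      by (auto simp: le_chain3 split: if_splits)
    obtain y z where "y \<le> 2" "z \<le> 2" "y \<le> b" "z \<le> c" "y + z = a"
      using *[OF bc(3,4)] by auto
    then show "\<exists>b\<^sub>1\<in>carrier chain3. \<exists>c\<^sub>1\<in>carrier chain3.
        b\<^sub>1 \<sqsubseteq>\<^bsub>ea_order chain3\<^esub> b \<and> c\<^sub>1 \<sqsubseteq>\<^bsub>ea_order chain3\<^esub> c \<and> osum chain3 b\<^sub>1 c\<^sub>1 = Some a"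
      using bc by (intro bexI[of _ y] bexI[of _ z]) (auto simp: le_chain3)
  qed
qed

lemma not_orthoalgebra_chain3: "\<not> orthoalgebra chain3"
  by (auto simp: orthoalgebra_def perp_def intro!: bexI[of _ 1])

theorem theorem4p4:
  shows "(\<forall>E :: 'a ea_struct. finite_MV_effect_algebra E \<longrightarrow>
           (boolean_effect_algebra E \<longleftrightarrow> (\<exists>f. S1_to_S4_operation E f)) \<and>
           ((\<exists>f. S1_to_S4_operation E f) \<longleftrightarrow> (\<exists>f. sequential_product E f)))
       \<and> (\<forall>E :: 'a ea_struct. effect_algebra E \<longrightarrow> (\<exists>f. S1_to_S3_operation E f))
       \<and> (\<exists>E :: nat ea_struct. finite_MV_effect_algebra E \<and>
           (\<exists>f. S1_to_S3_operation E f) \<and> \<not> (\<exists>f. S1_to_S4_operation E f))"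
proof (intro conjI allI impI)
  fix E :: "'a ea_struct"
  assume mv: "finite_MV_effect_algebra E"
  then interpret effect_algebra E
    by (simp add: finite_MV_effect_algebra_def)
  \<comment> \<open>The facts \<open>1\<close>, \<open>2\<close> and \<open>3\<close> close a cycle
    of implications.\<close>
  have 1: "boolean_effect_algebra E" if "S1_to_S4_operation E f" for f
    using that mv S1_to_S4_imp_orthoalgebra orthoalgebra_riesz_imp_boolean
    by (simp add: finite_MV_effect_algebra_def)
  have 2: "\<exists>f. sequential_product E f" if "boolean_effect_algebra E"
    using that boolean_imp_sequential_product by blast
  have 3: "S1_to_S4_operation E f" if "sequential_product E f" for f
    using that by (simp add: sequential_product_def)
  show "boolean_effect_algebra E \<longleftrightarrow> (\<exists>f. S1_to_S4_operation E f)"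
    using 1 2 3 by blast
  show "(\<exists>f. S1_to_S4_operation E f) \<longleftrightarrow> (\<exists>f. sequential_product E f)"
    using 1 2 3 by blast
next
  fix E :: "'a ea_struct"
  assume "effect_algebra E"
  then show "\<exists>f. S1_to_S3_operation E f"
    using effect_algebra.S1_to_S3_operation_if_zero by blast
next
  \<comment> \<open>The witness is \<open>chain3\<close>: being finite, it would be an orthoalgebra
    if it carried an operation with (S1)--(S4).\<close>
  show "\<exists>E :: nat ea_struct. finite_MV_effect_algebra E \<and>
      (\<exists>f. S1_to_S3_operation E f) \<and> \<not> (\<exists>f. S1_to_S4_operation E f)"
    using finite_MV_chain3 effect_algebra_chain3 not_orthoalgebra_chain3
      effect_algebra.S1_to_S4_imp_orthoalgebra effect_algebra.S1_to_S3_operation_if_zero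
    unfolding finite_MV_effect_algebra_def by blast
qed

end
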